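(* Let $G$ be a digraph. The following properties are equivalent: 1. $G$ is a directed trivially perfect graph. 2. $G\in\mathrm{Free}(\{D_1,\dots,D_{15}\})$. 3. $G\in\mathrm{Free}(\{D_1,D_2,D_3,D_4,D_5,D_6,D_{10},D_{11},D_{13},D_{14},D_{15}\})$ and $\mathrm{un}(G)\in\mathrm{Free}(\{C_4,P_4\})$. 4. $G\in\mathrm{Free}(\{D_1,D_2,D_3,D_4,D_5,D_6,D_{10},D_{11},D_{13},D_{14},D_{15}\})$ and $\mathrm{un}(G)$ is a trivially perfect graph.
   Context: Digraphs $G=(V,E)$ are finite with nonempty vertex set and $E\subseteq\{(u,v): u,v\in V,\ u\neq v\}$ (no loops, no multiple arcs; both $(u,v)$ and $(v,u)$ may be present). Undirected graphs are finite, simple and nonempty. All classes are closed under isomorphism. For a set $F$ of (di)graphs, $\mathrm{Free}(F)$ is the class of all (di)graphs having no induced sub(di)graph isomorphic to a member of $F$. The underlying graph $\mathrm{un}(G)$ of $G=(V,E)$ has vertex set $V$ and edge set $\{\{u,v\}:(u,v)\in E\}$. Operations on vertex-disjoint digraphs $G_1=(V_1,E_1)$, $G_2=(V_2,E_2)$: each result has vertex set $V_1\cup V_2$; $G_1\oplus G_2$ has arc set $E_1\cup E_2$; $G_1\otimes G_2$ has arc set $E_1\cup E_2\cup\{(u,v),(v,u):u\in V_1,v\in V_2\}$; $G_1\oslash G_2$ has arc set $E_1\cup E_2\cup\{(u,v):u\in V_1,v\in V_2\}$. The symbol $\bullet$ is a one-vertex digraph. Directed trivially perfect graphs: the smallest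 class containing every one-vertex digraph, containing $G_1\oplus G_2$ whenever it contains $G_1,G_2$, and containing $G\oslash\bullet$, $\bullet\oslash G$, $G\otimes\bullet$ whenever it contains $G$. Undirected trivially perfect graphs: the smallest class of graphs containing the one-vertex graphs, closed under disjoint union of two members, and closed under adding a new vertex adjacent to all existing vertices. $P_4$ is the path and $C_4$ the cycle on 4 vertices. Special digraphs: $\overleftrightarrow{K_2}$ has two vertices and both arcs between them; $\overrightarrow{P_2}$ has two vertices and exactly one arc; $\overleftrightarrow{I_2}$ has two vertices and no arc. $D_1$: vertices $a,b,c$, arcs $(a,b),(b,c)$. $D_2$: vertices $a,b,c$, arcs $(a,b),(b,c),(c,b)$. $D_3$: vertices $a,b,c$, arcs $(b,a),(b,c),(c,b)$. $D_4$: vertices $a,b,c$, arcs $(a,b),(b,c),(a,c),(c,a)$. $D_5$: the directed cycle $(a,b),(b,c),(c,a)$. $D_6$: vertices $a,b,c,d$, arcs $(b,a),(b,c),(d,c)$ and both arcs between $a,c$, between $a,d$, and between $b,d$. $D_7$: vertices $a,b,c,d$, both arcs between $a,b$, between $b,c$, and between $c,d$. $D_8$: vertices $a,b,c,d$, arcs $(a,b),(c,b),(c,d)$. $D_9=\overleftrightarrow{I_2}\otimes\overleftrightarrow{I_2}$, $D_{10}=\overrightarrow{P_2}\otimes\overleftrightarrow{I_2}$, $D_{11}=\overrightarrow{P_2}\otimes\overrightarrow{P_2}$, $D_{12}=\overleftrightarrow{I_2}\oslash\overleftrightarrow{I_2}$, $D_{13}=\overleftrightarrow{I_2}\oslash\overleftrightarrow{K_2}$,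 $D_{14}=\overleftrightarrow{K_2}\oslash\overleftrightarrow{I_2}$, $D_{15}=\overleftrightarrow{K_2}\oslash\overleftrightarrow{K_2}$. *)

theory Defs
  imports "Graph_Theory.Digraph_Isomorphism"
begin

section \<open>Digraphs\<close>

text \<open>
  The locale \<open>pair_digraph\<close> of the Graph-Theory library describes finite loop-free digraphs whose
  arcs are ordered pairs of vertices; it admits the empty vertex set, which is excluded here.
\<close>

definition is_digraph :: "'a pair_pre_digraph \<Rightarrow> bool" where
  "is_digraph G \<longleftrightarrow> pair_digraph G \<and> pverts G \<noteq> {}"

definition Free :: "'b pair_pre_digraph set \<Rightarrow> 'a pair_pre_digraph set" where
  "Free F = {G. is_digraph G \<and>
     \<not> (\<exists>H. induced_subgraph (with_proj H) (with_proj G) \<and>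
            (\<exists>D\<in>F. digraph_iso (with_proj D) (with_proj H)))}"

text \<open>
  The three operations below are meant for vertex-disjoint digraphs only; disjointness is
  required wherever they are used.
\<close>

definition vertex_disjoint :: "'a pair_pre_digraph \<Rightarrow> 'a pair_pre_digraph \<Rightarrow> bool" where
  "vertex_disjoint G H \<longleftrightarrow> pverts G \<inter> pverts H = {}"

definition disj_union :: "'a pair_pre_digraph \<Rightarrow> 'a pair_pre_digraph \<Rightarrow> 'a pair_pre_digraph"
    (infixl "\<oplus>" 65) where
  "G \<oplus> H = \<lparr>pverts = pverts G \<union> pverts H, parcs = parcs G \<union> parcs H\<rparr>"

definition series_comp :: "'a pair_pre_digraph \<Rightarrow> 'a pair_pre_digraph \<Rightarrow> 'a pair_pre_digraph"
    (infixl "\<otimes>" 70) where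
  "G \<otimes> H = \<lparr>pverts = pverts G \<union> pverts H,
     parcs = parcs G \<union> parcs H \<union> pverts G \<times> pverts H \<union> pverts H \<times> pverts G\<rparr>"

definition order_comp :: "'a pair_pre_digraph \<Rightarrow> 'a pair_pre_digraph \<Rightarrow> 'a pair_pre_digraph"
    (infixl "\<oslash>" 70) where
  "G \<oslash> H = \<lparr>pverts = pverts G \<union> pverts H,
     parcs = parcs G \<union> parcs H \<union> pverts G \<times> pverts H\<rparr>"

definition one_vertex :: "'a \<Rightarrow> 'a pair_pre_digraph" where
  "one_vertex v = \<lparr>pverts = {v}, parcs = {}\<rparr>"

text \<open>
  Since the one-vertex digraph on every vertex \<open>v\<close> is a member, closure under isomorphism needs no
  rule of its own.
\<close>

inductive_set directed_trivially_perfect :: "'a pair_pre_digraph set" where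
  dtp_vertex: "one_vertex v \<in> directed_trivially_perfect"
| dtp_union: "\<lbrakk>G\<^sub>1 \<in> directed_trivially_perfect; G\<^sub>2 \<in> directed_trivially_perfect;
     vertex_disjoint G\<^sub>1 G\<^sub>2\<rbrakk> \<Longrightarrow> G\<^sub>1 \<oplus> G\<^sub>2 \<in> directed_trivially_perfect"
| dtp_order_right: "\<lbrakk>G \<in> directed_trivially_perfect; vertex_disjoint G (one_vertex v)\<rbrakk>
     \<Longrightarrow> G \<oslash> one_vertex v \<in> directed_trivially_perfect"
| dtp_order_left: "\<lbrakk>G \<in> directed_trivially_perfect; vertex_disjoint (one_vertex v) G\<rbrakk>
     \<Longrightarrow> one_vertex v \<oslash> G \<in> directed_trivially_perfect"
| dtp_series: "\<lbrakk>G \<in> directed_trivially_perfect; vertex_disjoint G (one_vertex v)\<rbrakk>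
     \<Longrightarrow> G \<otimes> one_vertex v \<in> directed_trivially_perfect"


section \<open>Undirected graphs\<close>

text \<open>
  The library treats undirected graphs as symmetric digraphs; here edges are two-element sets.
\<close>

record 'a ugraph =
  uverts :: "'a set"
  uedges :: "'a set set"

definition is_ugraph :: "'a ugraph \<Rightarrow> bool" where
  "is_ugraph G \<longleftrightarrow> finite (uverts G) \<and> uverts G \<noteq> {} \<and>
     uedges G \<subseteq> {{u, v} |u v. u \<in> uverts G \<and> v \<in> uverts G \<and> u \<noteq> v}"

definition u_induced_subgraph :: "'a ugraph \<Rightarrow> 'a ugraph \<Rightarrow> bool" where
  "u_induced_subgraph H G \<longleftrightarrow> uverts H \<subseteq> uverts G \<and> uedges H = {e \<in> uedges G. e \<subseteq> uverts H}"

definition u_iso :: "'a ugraph \<Rightarrow> 'b ugraph \<Rightarrow> bool" where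
  "u_iso G H \<longleftrightarrow> (\<exists>f. bij_betw f (uverts G) (uverts H) \<and>
     (\<forall>u\<in>uverts G. \<forall>v\<in>uverts G. {u, v} \<in> uedges G \<longleftrightarrow> {f u, f v} \<in> uedges H))"

definition uFree :: "'b ugraph set \<Rightarrow> 'a ugraph set" where
  "uFree F = {G. is_ugraph G \<and> \<not> (\<exists>H. u_induced_subgraph H G \<and> (\<exists>D\<in>F. u_iso D H))}"

definition un :: "'a pair_pre_digraph \<Rightarrow> 'a ugraph" where
  "un G = \<lparr>uverts = pverts G, uedges = {{u, v} |u v. (u, v) \<in> parcs G}\<rparr>"

inductive_set trivially_perfect :: "'a ugraph set" where
  tp_vertex: "\<lparr>uverts = {v}, uedges = {}\<rparr> \<in> trivially_perfect"
| tp_union: "\<lbrakk>G\<^sub>1 \<in> trivially_perfect; G\<^sub>2 \<in> trivially_perfect; uverts G\<^sub>1 \<inter> uverts G\<^sub>2 = {}\<rbrakk>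
     \<Longrightarrow> \<lparr>uverts = uverts G\<^sub>1 \<union> uverts G\<^sub>2, uedges = uedges G\<^sub>1 \<union> uedges G\<^sub>2\<rparr> \<in> trivially_perfect"
| tp_dominating: "\<lbrakk>G \<in> trivially_perfect; v \<notin> uverts G\<rbrakk>
     \<Longrightarrow> \<lparr>uverts = insert v (uverts G), uedges = uedges G \<union> {{u, v} |u. u \<in> uverts G}\<rparr>
         \<in> trivially_perfect"

definition P4 :: "nat ugraph" where
  "P4 = \<lparr>uverts = {0, 1, 2, 3}, uedges = {{0, 1}, {1, 2}, {2, 3}}\<rparr>"

definition C4 :: "nat ugraph" where
  "C4 = \<lparr>uverts = {0, 1, 2, 3}, uedges = {{0, 1}, {1, 2}, {2, 3}, {3, 0}}\<rparr>"


section \<open>Special digraphs\<close>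

text \<open>
  In \<open>D1\<close> to \<open>D8\<close> the vertices $a, b, c, d$ are \<open>0, 1, 2, 3\<close>. The two-vertex digraphs take their
  vertices as parameters, so that the two operands in \<open>D9\<close> to \<open>D15\<close> are vertex-disjoint.
\<close>

definition biarcs :: "'a \<Rightarrow> 'a \<Rightarrow> 'a rel" where
  "biarcs u v = {(u, v), (v, u)}"

definition K2 :: "'a \<Rightarrow> 'a \<Rightarrow> 'a pair_pre_digraph" where
  "K2 u v = \<lparr>pverts = {u, v}, parcs = biarcs u v\<rparr>"

definition P2 :: "'a \<Rightarrow> 'a \<Rightarrow> 'a pair_pre_digraph" where
  "P2 u v = \<lparr>pverts = {u, v}, parcs = {(u, v)}\<rparr>"

definition I2 :: "'a \<Rightarrow> 'a \<Rightarrow> 'a pair_pre_digraph" where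
  "I2 u v = \<lparr>pverts = {u, v}, parcs = {}\<rparr>"

definition D1 :: "nat pair_pre_digraph" where
  "D1 = \<lparr>pverts = {0, 1, 2}, parcs = {(0, 1), (1, 2)}\<rparr>"

definition D2 :: "nat pair_pre_digraph" where
  "D2 = \<lparr>pverts = {0, 1, 2}, parcs = {(0, 1), (1, 2), (2, 1)}\<rparr>"

definition D3 :: "nat pair_pre_digraph" where
  "D3 = \<lparr>pverts = {0, 1, 2}, parcs = {(1, 0), (1, 2), (2, 1)}\<rparr>"

definition D4 :: "nat pair_pre_digraph" where
  "D4 = \<lparr>pverts = {0, 1, 2}, parcs = {(0, 1), (1, 2), (0, 2), (2, 0)}\<rparr>"

definition D5 :: "nat pair_pre_digraph" where
  "D5 = \<lparr>pverts = {0, 1, 2}, parcs = {(0, 1), (1, 2), (2, 0)}\<rparr>"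

definition D6 :: "nat pair_pre_digraph" where
  "D6 = \<lparr>pverts = {0, 1, 2, 3},
     parcs = {(1, 0), (1, 2), (3, 2)} \<union> biarcs 0 2 \<union> biarcs 0 3 \<union> biarcs 1 3\<rparr>"

definition D7 :: "nat pair_pre_digraph" where
  "D7 = \<lparr>pverts = {0, 1, 2, 3}, parcs = biarcs 0 1 \<union> biarcs 1 2 \<union> biarcs 2 3\<rparr>"

definition D8 :: "nat pair_pre_digraph" where
  "D8 = \<lparr>pverts = {0, 1, 2, 3}, parcs = {(0, 1), (2, 1), (2, 3)}\<rparr>"

definition D9 :: "nat pair_pre_digraph" where "D9 = I2 0 1 \<otimes> I2 2 3"
definition D10 :: "nat pair_pre_digraph" where "D10 = P2 0 1 \<otimes> I2 2 3"
definition D11 :: "nat pair_pre_digraph" where "D11 = P2 0 1 \<otimes> P2 2 3"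
definition D12 :: "nat pair_pre_digraph" where "D12 = I2 0 1 \<oslash> I2 2 3"
definition D13 :: "nat pair_pre_digraph" where "D13 = I2 0 1 \<oslash> K2 2 3"
definition D14 :: "nat pair_pre_digraph" where "D14 = K2 0 1 \<oslash> I2 2 3"
definition D15 :: "nat pair_pre_digraph" where "D15 = K2 0 1 \<oslash> K2 2 3"

end

(*
  Let u < v mean that (u,v) is an arc and (v,u) is not. If none of D1, ..., D15 is induced in G, then
  < is a strict partial order (D1, D4, D5), and no triangle has one pair joined by a single arc, one
  by both arcs and one by none (D2, D3). By Gallai's argument for colourings without rainbow
  triangles, connectedness of un(G) then implies that the comparability graph of < or the graph of
  the bidirected pairs is connected. Both graphs are free of P4 and C4 (D6, D8, D12-D15 and D6, D7,
  D9-D11), so by Wolk's theorem the connected one has a universal vertex. In the comparability graph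
  the vertices below it or those above it form a chain, so < has a least or a greatest element. Hence
  G is disconnected or has a vertex that can be split off by one of the operations, and induction
  applies. Conversely, a connected digraph none of whose vertices can be split off in this way is
  never induced in a directed trivially perfect graph, and D1, ..., D15 are of this kind.
*)
theory Submission
  imports Defs
begin

section \<open>Embeddings\<close>

text \<open>The vertex types may differ because the special digraphs live on \<open>nat\<close>.
  Arcs are preserved in both directions, so the image is an induced copy.\<close>

definition embeds :: "'b pair_pre_digraph \<Rightarrow> 'a pair_pre_digraph \<Rightarrow> bool" where
  "embeds D G \<longleftrightarrow> (\<exists>f. inj_on f (pverts D) \<and> f ` pverts D \<subseteq> pverts G \<and>
     (\<forall>u\<in>pverts D. \<forall>v\<in>pverts D. (u, v) \<in> parcs D \<longleftrightarrow> (f u, f v) \<in> parcs G))"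

definition induce :: "'a pair_pre_digraph \<Rightarrow> 'a set \<Rightarrow> 'a pair_pre_digraph" where
  "induce G A = \<lparr>pverts = A, parcs = parcs G \<inter> A \<times> A\<rparr>"

text \<open>Connectedness through cuts instead of paths, for symmetric relations. Its negation
  directly yields the cut along which a digraph is split.\<close>

definition connected_on :: "'a set \<Rightarrow> ('a \<Rightarrow> 'a \<Rightarrow> bool) \<Rightarrow> bool" where
  "connected_on V R \<longleftrightarrow> (\<forall>A\<subseteq>V. A \<noteq> {} \<longrightarrow> A \<noteq> V \<longrightarrow> (\<exists>a\<in>A. \<exists>b\<in>V - A. R a b))"

definition adjacent :: "'a pair_pre_digraph \<Rightarrow> 'a \<Rightarrow> 'a \<Rightarrow> bool" where
  "adjacent G u v \<longleftrightarrow> (u, v) \<in> parcs G \<or> (v, u) \<in> parcs G"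

definition biarc :: "'a pair_pre_digraph \<Rightarrow> 'a \<Rightarrow> 'a \<Rightarrow> bool" where
  "biarc G u v \<longleftrightarrow> (u, v) \<in> parcs G \<and> (v, u) \<in> parcs G"

definition oneway :: "'a pair_pre_digraph \<Rightarrow> 'a \<Rightarrow> 'a \<Rightarrow> bool" where
  "oneway G u v \<longleftrightarrow> (u, v) \<in> parcs G \<and> (v, u) \<notin> parcs G"

text \<open>The clauses describe a vertex that can be split off by \<otimes>, by \<oslash> on the
  left and by \<oslash> on the right. The only vertex of a one-vertex digraph is dominating
  vacuously.\<close>

definition dominating :: "'a pair_pre_digraph \<Rightarrow> 'a \<Rightarrow> bool" where
  "dominating G v \<longleftrightarrow> (\<forall>w\<in>pverts G - {v}. biarc G v w) \<or>
     (\<forall>w\<in>pverts G - {v}. oneway G v w) \<or> (\<forall>w\<in>pverts G - {v}. oneway G w v)"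

section \<open>Digraphs and induced embeddings\<close>

lemma is_digraph_iff:
  "is_digraph G \<longleftrightarrow> finite (pverts G) \<and> pverts G \<noteq> {} \<and> parcs G \<subseteq> pverts G \<times> pverts G \<and>
     (\<forall>v. (v, v) \<notin> parcs G)"
proof
  assume "is_digraph G"
  then interpret pair_digraph G by (simp add: is_digraph_def)
  show "finite (pverts G) \<and> pverts G \<noteq> {} \<and> parcs G \<subseteq> pverts G \<times> pverts G \<and>
     (\<forall>v. (v, v) \<notin> parcs G)"
    using \<open>is_digraph G\<close> pair_finite_verts in_arcsD1 in_arcsD2 pair_no_loops
    by (fastforce simp: is_digraph_def)
next
  assume *: "finite (pverts G) \<and> pverts G \<noteq> {} \<and> parcs G \<subseteq> pverts G \<times> pverts G \<and>
     (\<forall>v. (v, v) \<notin> parcs G)"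
  then have "finite (parcs G)"
    by (meson finite_SigmaI finite_subset)
  with * show "is_digraph G"
    unfolding is_digraph_def by (auto intro!: pair_digraph.intro pair_fin_digraph.intro
      pair_wf_digraph.intro pair_loopfree_digraph.intro pair_fin_digraph_axioms.intro
      pair_loopfree_digraph_axioms.intro)
qed

lemma arc_in_verts:
  assumes "is_digraph G" "(u, v) \<in> parcs G" shows "u \<in> pverts G" "v \<in> pverts G" "u \<noteq> v"
  using assms by (auto simp: is_digraph_iff)

text \<open>An embedding gives the subdigraph induced on its image. Conversely, arcs are pairs with
  the projections as tail and head, so the vertex map of an isomorphism determines its arc
  map.\<close>

lemma embeds_iff_induced_subgraph:
  assumes "is_digraph D" and "is_digraph G"
  shows "embeds D G \<longleftrightarrow>
    (\<exists>H. induced_subgraph (with_proj H) (with_proj G) \<and> digraph_iso (with_proj D) (with_proj H))"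
proof
  assume "embeds D G"
  then obtain f where inj: "inj_on f (pverts D)" and img: "f ` pverts D \<subseteq> pverts G"
    and arcs: "\<And>u v. u \<in> pverts D \<Longrightarrow> v \<in> pverts D \<Longrightarrow>
      (u, v) \<in> parcs D \<longleftrightarrow> (f u, f v) \<in> parcs G"
    unfolding embeds_def by blast
  define H where "H = induce G (f ` pverts D)"
  have wf: "wf_digraph (with_proj D)" "wf_digraph (with_proj G)" "wf_digraph (with_proj H)"
    using assms unfolding is_digraph_iff wf_digraph_wp_iff H_def induce_def
    by (auto simp: pair_wf_digraph_def)
  have "induced_subgraph (with_proj H) (with_proj G)"
    using wf img unfolding induced_subgraph_def subgraph_def compatible_def
    by (auto simp: H_def induce_def)
  moreover have "digraph_iso (with_proj D) (with_proj H)"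
    unfolding digraph_iso_def
  proof (intro exI conjI)
    let ?iso = "\<lparr>iso_verts = f, iso_arcs = map_prod f f, iso_head = snd, iso_tail = fst\<rparr>"
    have sub: "parcs D \<subseteq> pverts D \<times> pverts D"
      using assms by (simp add: is_digraph_iff)
    show "pre_digraph.digraph_isomorphism (with_proj D) ?iso"
      using wf inj sub unfolding pre_digraph.digraph_isomorphism_def
      by (auto intro: inj_on_subset[OF map_prod_inj_on[OF inj inj]])
    have "map_prod f f ` parcs D = parcs G \<inter> f ` pverts D \<times> f ` pverts D"
      using sub arcs by force
    then show "with_proj H = app_iso ?iso (with_proj D)"
      by (simp add: app_iso_def with_proj_def H_def induce_def)
  qed
  ultimately show "\<exists>H. induced_subgraph (with_proj H) (with_proj G) \<and>
    digraph_iso (with_proj D) (with_proj H)" by blast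
next
  assume "\<exists>H. induced_subgraph (with_proj H) (with_proj G) \<and>
    digraph_iso (with_proj D) (with_proj H)"
  then obtain H iso where ind: "induced_subgraph (with_proj H) (with_proj G)"
    and iso: "pre_digraph.digraph_isomorphism (with_proj D) iso"
    and H: "with_proj H = app_iso iso (with_proj D)"
    unfolding digraph_iso_def by blast
  let ?f = "iso_verts iso"
  have verts: "pverts H = ?f ` pverts D" and arcs: "parcs H = iso_arcs iso ` parcs D"
    and tail: "iso_tail iso = fst" and head: "iso_head iso = snd"
    using H by (simp_all add: app_iso_def with_proj_def)
  have inj: "inj_on ?f (pverts D)"
    and iso_arcs: "\<And>u v. (u, v) \<in> parcs D \<Longrightarrow> iso_arcs iso (u, v) = (?f u, ?f v)"
    using iso tail head unfolding pre_digraph.digraph_isomorphism_def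
    by (auto simp: prod_eq_iff)
  have arcs': "parcs H = (\<lambda>(u, v). (?f u, ?f v)) ` parcs D"
    unfolding arcs using iso_arcs by (intro image_cong) auto
  have sub: "pverts H \<subseteq> pverts G" and arcs_H: "parcs H = parcs G \<inter> pverts H \<times> pverts H"
    using ind by (auto simp: induced_subgraph_def subgraph_def)
  have "(u, v) \<in> parcs D \<longleftrightarrow> (?f u, ?f v) \<in> parcs G" if "u \<in> pverts D" "v \<in> pverts D" for u v
  proof -
    have "(?f u, ?f v) \<in> parcs G \<longleftrightarrow> (?f u, ?f v) \<in> parcs H"
      using that by (simp add: arcs_H verts)
    also have "\<dots> \<longleftrightarrow> (u, v) \<in> parcs D"
    proof
      assume "(?f u, ?f v) \<in> parcs H"
      then obtain x y where xy: "(x, y) \<in> parcs D" "?f u = ?f x" "?f v = ?f y"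
        unfolding arcs' by auto
      moreover have "x \<in> pverts D" "y \<in> pverts D"
        using xy(1) assms(1) by (auto simp: is_digraph_iff)
      ultimately show "(u, v) \<in> parcs D"
        using inj that by (metis inj_onD)
    qed (force simp: arcs')
    finally show ?thesis by simp
  qed
  then show "embeds D G"
    unfolding embeds_def using inj sub verts by blast
qed

lemma Free_iff_not_embeds:
  assumes "is_digraph G" and "\<And>D. D \<in> F \<Longrightarrow> is_digraph D"
  shows "G \<in> Free F \<longleftrightarrow> (\<forall>D\<in>F. \<not> embeds D G)"
  using assms by (auto simp: Free_def embeds_iff_induced_subgraph)

lemma embeds_trans:
  assumes "embeds C D" and "embeds D G"
  shows "embeds C G"
proof -
  obtain f where f: "inj_on f (pverts C)" "f ` pverts C \<subseteq> pverts D"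
      "\<forall>u\<in>pverts C. \<forall>v\<in>pverts C. (u, v) \<in> parcs C \<longleftrightarrow> (f u, f v) \<in> parcs D"
    using assms(1) unfolding embeds_def by auto
  obtain g where g: "inj_on g (pverts D)" "g ` pverts D \<subseteq> pverts G"
      "\<forall>u\<in>pverts D. \<forall>v\<in>pverts D. (u, v) \<in> parcs D \<longleftrightarrow> (g u, g v) \<in> parcs G"
    using assms(2) unfolding embeds_def by auto
  have "inj_on (g \<circ> f) (pverts C)"
    by (rule comp_inj_on[OF f(1) inj_on_subset[OF g(1) f(2)]])
  moreover have "(g \<circ> f) ` pverts C \<subseteq> pverts G"
    using f(2) g(2) by auto
  moreover have "(u, v) \<in> parcs C \<longleftrightarrow> ((g \<circ> f) u, (g \<circ> f) v) \<in> parcs G"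
    if "u \<in> pverts C" "v \<in> pverts C" for u v
    using that f(2,3) g(3) by (simp add: image_subset_iff)
  ultimately show ?thesis
    unfolding embeds_def by blast
qed

lemma embeds_induce:
  assumes "A \<subseteq> pverts G" shows "embeds (induce G A) G"
  unfolding embeds_def induce_def using assms by (intro exI[of _ id]) auto

lemma is_digraph_induce:
  assumes "is_digraph G" "A \<subseteq> pverts G" "A \<noteq> {}" shows "is_digraph (induce G A)"
  using assms finite_subset unfolding is_digraph_iff induce_def by auto

text \<open>The vertices of \<open>D\<close> mapped into \<open>A\<close> form a set that no edge of
  \<open>D\<close> leaves, since its image would join \<open>A\<close> to \<open>B\<close>.
  Connectedness makes this set empty or everything.\<close>

lemma embeds_into_part:
  assumes "embeds D G" "connected_on (pverts D) (adjacent D)"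
    and "pverts G = A \<union> B" "\<And>a b. a \<in> A \<Longrightarrow> b \<in> B \<Longrightarrow> \<not> adjacent G a b"
  shows "embeds D (induce G A) \<or> embeds D (induce G B)"
proof -
  obtain f where f: "inj_on f (pverts D)" "f ` pverts D \<subseteq> pverts G"
      "\<forall>u\<in>pverts D. \<forall>v\<in>pverts D. (u, v) \<in> parcs D \<longleftrightarrow> (f u, f v) \<in> parcs G"
    using assms(1) unfolding embeds_def by blast
  have into: "embeds D (induce G C)" if "f ` pverts D \<subseteq> C" for C
    unfolding embeds_def induce_def using f that by (intro exI[of _ f]) auto
  let ?U = "{u \<in> pverts D. f u \<in> A}"
  have "?U = {} \<or> ?U = pverts D"
  proof (rule ccontr)
    assume "\<not> ?thesis"
    then obtain u v where "u \<in> ?U" "v \<in> pverts D - ?U" "adjacent D u v"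
      using assms(2)[unfolded connected_on_def, rule_format, of ?U] by auto
    moreover from this have "f v \<in> B" "adjacent G (f u) (f v)"
      using f assms(3) by (auto simp: adjacent_def)
    ultimately show False using assms(4) by blast
  qed
  then show ?thesis
  proof
    assume "?U = {}"
    then show ?thesis using into f(2) assms(3) by blast
  next
    assume "?U = pverts D"
    then show ?thesis using into by blast
  qed
qed

text \<open>A vertex mapped to \<open>v\<close> would inherit the arcs at \<open>v\<close> and be
  dominating in \<open>D\<close>; hence the image misses \<open>v\<close>.\<close>

lemma embeds_avoiding_dominating:
  assumes "embeds D G" "dominating G v" "\<And>u. u \<in> pverts D \<Longrightarrow> \<not> dominating D u"
  shows "embeds D (induce G (pverts G - {v}))"
proof -
  obtain f where f: "inj_on f (pverts D)" "f ` pverts D \<subseteq> pverts G"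
      "\<forall>u\<in>pverts D. \<forall>v\<in>pverts D. (u, v) \<in> parcs D \<longleftrightarrow> (f u, f v) \<in> parcs G"
    using assms(1) unfolding embeds_def by blast
  have "v \<notin> f ` pverts D"
  proof
    assume "v \<in> f ` pverts D"
    then obtain u where u: "u \<in> pverts D" "v = f u" by blast
    have "f w \<in> pverts G - {f u}" if "w \<in> pverts D - {u}" for w
      using that f(1,2) u by (auto dest: inj_onD)
    then have "dominating D u"
      using assms(2) f(3) u unfolding dominating_def biarc_def oneway_def
      by (elim disjE) auto
    then show False using assms(3) u by blast
  qed
  then show ?thesis
    unfolding embeds_def induce_def using f by (intro exI[of _ f]) auto
qed

section \<open>Building up and taking apart directed trivially perfect digraphs\<close>

lemma dominating_comp:
  assumes "v \<notin> pverts G" "is_digraph G"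
  shows "dominating (G \<oslash> one_vertex v) v" "dominating (one_vertex v \<oslash> G) v"
    "dominating (G \<otimes> one_vertex v) v"
  using assms unfolding is_digraph_iff dominating_def biarc_def oneway_def order_comp_def
    series_comp_def one_vertex_def
  by auto

lemma induce_comp:
  assumes "v \<notin> pverts G" "is_digraph G"
  shows "induce (G \<oslash> one_vertex v) (pverts (G \<oslash> one_vertex v) - {v}) = G"
    "induce (one_vertex v \<oslash> G) (pverts (one_vertex v \<oslash> G) - {v}) = G"
    "induce (G \<otimes> one_vertex v) (pverts (G \<otimes> one_vertex v) - {v}) = G"
  using assms unfolding is_digraph_iff induce_def order_comp_def series_comp_def one_vertex_def
  by (auto intro!: pair_pre_digraph.equality)

lemma is_digraph_dtp: "G \<in> directed_trivially_perfect \<Longrightarrow> is_digraph G"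
  by (induction rule: directed_trivially_perfect.induct)
    (auto simp: is_digraph_iff one_vertex_def disj_union_def order_comp_def series_comp_def
      vertex_disjoint_def)

text \<open>No construction step creates a first copy of such a \<open>D\<close>: being connected,
  it lies on one side of a disjoint union; having no dominating vertex, it avoids the vertex added
  by a composition.\<close>

lemma dtp_not_embeds:
  assumes "G \<in> directed_trivially_perfect" "pverts D \<noteq> {}"
    and "connected_on (pverts D) (adjacent D)" "\<And>u. u \<in> pverts D \<Longrightarrow> \<not> dominating D u"
  shows "\<not> embeds D G"
  using assms(1)
proof (induction rule: directed_trivially_perfect.induct)
  case (dtp_vertex v)
  show ?case
  proof
    assume "embeds D (one_vertex v)"
    then obtain f where "inj_on f (pverts D)" "f ` pverts D \<subseteq> {v}"
      unfolding embeds_def one_vertex_def by auto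
    then have "\<forall>u\<in>pverts D. \<forall>w\<in>pverts D. u = w"
      by (simp add: inj_on_def image_subset_iff)
    \<comment> \<open>The single vertex of \<open>D\<close> is dominating, since the quantifiers
      range over the empty set.\<close>
    then show False
      using assms(2,4) unfolding dominating_def by blast
  qed
next
  case (dtp_union G\<^sub>1 G\<^sub>2)
  have dig: "is_digraph G\<^sub>1" "is_digraph G\<^sub>2"
    using dtp_union is_digraph_dtp by auto
  then have "induce (G\<^sub>1 \<oplus> G\<^sub>2) (pverts G\<^sub>1) = G\<^sub>1" "induce (G\<^sub>1 \<oplus> G\<^sub>2) (pverts G\<^sub>2) = G\<^sub>2"
    using dtp_union.hyps(3) unfolding induce_def disj_union_def vertex_disjoint_def
    by (auto intro!: pair_pre_digraph.equality simp: disjoint_iff dest: arc_in_verts)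
  moreover have "\<not> adjacent (G\<^sub>1 \<oplus> G\<^sub>2) a b" if "a \<in> pverts G\<^sub>1" "b \<in> pverts G\<^sub>2" for a b
    using that dig dtp_union.hyps(3)
    by (auto simp: adjacent_def disj_union_def vertex_disjoint_def disjoint_iff
        dest: arc_in_verts)
  ultimately show ?case
    using embeds_into_part[OF _ assms(3), of "G\<^sub>1 \<oplus> G\<^sub>2" "pverts G\<^sub>1" "pverts G\<^sub>2"] dtp_union
    by (auto simp: disj_union_def)
next
  case (dtp_order_right G v)
  then have "v \<notin> pverts G" "is_digraph G"
    by (auto simp: is_digraph_dtp vertex_disjoint_def one_vertex_def)
  then show ?case
    using embeds_avoiding_dominating[OF _ dominating_comp(1) assms(4)] dtp_order_right
    by (metis induce_comp(1))
next
  case (dtp_order_left G v)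
  then have "v \<notin> pverts G" "is_digraph G"
    by (auto simp: is_digraph_dtp vertex_disjoint_def one_vertex_def)
  then show ?case
    using embeds_avoiding_dominating[OF _ dominating_comp(2) assms(4)] dtp_order_left
    by (metis induce_comp(2))
next
  case (dtp_series G v)
  then have "v \<notin> pverts G" "is_digraph G"
    by (auto simp: is_digraph_dtp vertex_disjoint_def one_vertex_def)
  then show ?case
    using embeds_avoiding_dominating[OF _ dominating_comp(3) assms(4)] dtp_series
    by (metis induce_comp(3))
qed

text \<open>This lemma and the next run the generating rules backwards, from \<open>G\<close> to
  induced subdigraphs.\<close>

lemma dtp_partI:
  assumes "is_digraph G" "pverts G = A \<union> B" "A \<inter> B = {}"
    and "\<And>a b. a \<in> A \<Longrightarrow> b \<in> B \<Longrightarrow> \<not> adjacent G a b"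
    and "induce G A \<in> directed_trivially_perfect" "induce G B \<in> directed_trivially_perfect"
  shows "G \<in> directed_trivially_perfect"
proof -
  have "G = induce G A \<oplus> induce G B"
    using assms(1,2,4) unfolding is_digraph_iff induce_def disj_union_def adjacent_def
    by (intro pair_pre_digraph.equality) auto
  then show ?thesis
    using dtp_union[OF assms(5,6)] assms(3) by (simp add: vertex_disjoint_def induce_def)
qed

lemma dtp_dominatingI:
  assumes "is_digraph G" "v \<in> pverts G" "dominating G v"
    and "induce G (pverts G - {v}) \<in> directed_trivially_perfect"
  shows "G \<in> directed_trivially_perfect"
proof -
  let ?H = "induce G (pverts G - {v})"
  have arcs: "parcs G \<subseteq> pverts G \<times> pverts G" "\<And>v. (v, v) \<notin> parcs G"
    using assms(1) by (auto simp: is_digraph_iff)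
  have disj: "vertex_disjoint ?H (one_vertex v)" "vertex_disjoint (one_vertex v) ?H"
    by (auto simp: vertex_disjoint_def induce_def one_vertex_def)
  consider "\<forall>w\<in>pverts G - {v}. biarc G v w" | "\<forall>w\<in>pverts G - {v}. oneway G v w"
    | "\<forall>w\<in>pverts G - {v}. oneway G w v"
    using assms(3) unfolding dominating_def by blast
  then show ?thesis
  proof cases
    case 1
    then have "G = ?H \<otimes> one_vertex v"
      using assms(2) arcs unfolding induce_def series_comp_def one_vertex_def biarc_def
      by (intro pair_pre_digraph.equality) auto
    then show ?thesis using dtp_series[OF assms(4) disj(1)] by simp
  next
    case 2
    then have "G = one_vertex v \<oslash> ?H"
      using assms(2) arcs unfolding induce_def order_comp_def one_vertex_def oneway_def
      by (intro pair_pre_digraph.equality) auto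
    then show ?thesis using dtp_order_left[OF assms(4) disj(2)] by simp
  next
    case 3
    then have "G = ?H \<oslash> one_vertex v"
      using assms(2) arcs unfolding induce_def order_comp_def one_vertex_def oneway_def
      by (intro pair_pre_digraph.equality) auto
    then show ?thesis using dtp_order_right[OF assms(4) disj(1)] by simp
  qed
qed

section \<open>Universal vertices\<close>

text \<open>Gallai's argument. If \<open>K\<close> is disconnected, some \<open>P\<close>-edge
  \<open>a b\<close> crosses a cut of \<open>K\<close>. If the \<open>P\<close>-component of
  \<open>a\<close> is not everything, some \<open>z\<close> outside has a \<open>K\<close>-edge to
  it. Absence of rainbow triangles spreads this to the whole component, so \<open>z\<close> is
  \<open>K\<close>-adjacent to \<open>a\<close> and to \<open>b\<close>, and one of these edges
  crosses the cut.\<close>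

lemma connected_on_cases:
  assumes "connected_on V (\<lambda>x y. P x y \<or> K x y)"
    and symP: "\<And>x y. P x y \<Longrightarrow> P y x" and symK: "\<And>x y. K x y \<Longrightarrow> K y x"
    and no_rainbow: "\<And>x y z. P x y \<Longrightarrow> K x z \<Longrightarrow> y \<noteq> z \<Longrightarrow> P y z \<or> K y z"
  shows "connected_on V P \<or> connected_on V K"
proof (rule disjCI)
  assume "\<not> connected_on V K"
  then obtain A where A: "A \<subseteq> V" "A \<noteq> {}" "A \<noteq> V" "\<And>x y. x \<in> A \<Longrightarrow> y \<in> V - A \<Longrightarrow> \<not> K x y"
    unfolding connected_on_def by blast
  then obtain a b where ab: "a \<in> A" "b \<in> V - A" "P a b"
    using assms(1) unfolding connected_on_def by meson
  \<comment> \<open>\<open>P\<close> is not confined to \<open>V\<close> by hypothesis, so its walks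
    are confined here.\<close>
  let ?Q = "\<lambda>x y. P x y \<and> x \<in> V \<and> y \<in> V"
  have "symp ?Q\<^sup>*\<^sup>*"
    by (intro symp_rtranclp sympI) (auto intro: symP)
  define C where "C = {x \<in> V. ?Q\<^sup>*\<^sup>* a x}"
  have a: "a \<in> C" and b: "b \<in> C"
    using A(1) ab by (auto simp: C_def)
  have closed: "y \<in> C" if "x \<in> C" "y \<in> V" "P x y" for x y
    using that unfolding C_def by (auto intro: rtranclp.rtrancl_into_rtrancl)
  have "C = V"
  proof (rule ccontr)
    assume "C \<noteq> V"
    moreover have "C \<subseteq> V" "C \<noteq> {}" using a by (auto simp: C_def)
    ultimately obtain c z where cz: "c \<in> C" "z \<in> V - C" "P c z \<or> K c z"
      using assms(1) unfolding connected_on_def by meson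
    then have "K c z" using closed by blast
    have "K x z" if "?Q\<^sup>*\<^sup>* c x" for x
      using that
    proof (induction rule: rtranclp_induct)
      case base show ?case by fact
    next
      case (step x y)
      have "?Q\<^sup>*\<^sup>* a c" using cz(1) by (simp add: C_def)
      also have "?Q\<^sup>*\<^sup>* c y" using step.hyps by (rule rtranclp.rtrancl_into_rtrancl)
      finally have "y \<in> C" using step.hyps(2) by (simp add: C_def)
      \<comment> \<open>A \<open>P\<close>-edge from \<open>y\<close> to \<open>z\<close> would put
        \<open>z\<close> into the component, so the third side of the triangle \<open>x y z\<close>
        must be a \<open>K\<close>-edge.\<close>
      then have "y \<noteq> z" "\<not> P y z" using cz(2) closed by auto
      then show ?case using no_rainbow step by blast
    qed
    moreover have "?Q\<^sup>*\<^sup>* c a"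
      using \<open>symp ?Q\<^sup>*\<^sup>*\<close> cz(1) by (auto simp: C_def dest: sympD)
    moreover from this have "?Q\<^sup>*\<^sup>* c b"
      by (rule rtranclp.rtrancl_into_rtrancl) (use A(1) ab in auto)
    ultimately have "K a z" "K b z" by auto
    then show False using A(4) ab symK cz(2) by blast
  qed
  show "connected_on V P"
    unfolding connected_on_def
  proof (intro allI impI)
    fix B assume B: "B \<subseteq> V" "B \<noteq> {}" "B \<noteq> V"
    \<comment> \<open>Reachability from \<open>a\<close> is turned back into cuts; a set without
      \<open>a\<close> is handled through its complement and symmetry.\<close>
    have leave: "\<exists>x\<in>S. \<exists>y\<in>V - S. P x y" if "a \<in> S" "S \<subseteq> V" "S \<noteq> V" for S
    proof (rule ccontr)
      assume stay: "\<not> ?thesis"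
      have "x \<in> S" if "?Q\<^sup>*\<^sup>* a x" for x
        using that by (induction rule: rtranclp_induct) (use \<open>a \<in> S\<close> stay in auto)
      then show False using that \<open>C = V\<close> by (auto simp: C_def)
    qed
    show "\<exists>x\<in>B. \<exists>y\<in>V - B. P x y"
    proof (cases "a \<in> B")
      case True
      then show ?thesis using leave B by blast
    next
      case False
      then have "a \<in> V - B" using a \<open>C = V\<close> by blast
      then obtain x y where "x \<in> V - B" "y \<in> V - (V - B)" "P x y"
        using leave[of "V - B"] B by blast
      then show ?thesis using symP by blast
    qed
  qed
qed

text \<open>Wolk's theorem. The hypothesis \<open>free\<close> says nothing about
  \<open>R a d\<close> and so excludes induced paths and 4-cycles at once. A vertex \<open>v\<close>
  of maximum degree works: otherwise there is a path \<open>v x y\<close> with \<open>y\<close> not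
  adjacent to \<open>v\<close>, and by \<open>free\<close> all other neighbours of \<open>v\<close>
  are adjacent to \<open>x\<close>, which gives \<open>x\<close> a larger degree.\<close>

lemma connected_P4_C4_free_universal:
  assumes "finite V" "V \<noteq> {}" "connected_on V R"
    and sym: "\<And>x y. R x y \<Longrightarrow> R y x" and irrefl: "\<And>x. \<not> R x x"
    and free: "\<And>a b c d. {a, b, c, d} \<subseteq> V \<Longrightarrow> distinct [a, b, c, d] \<Longrightarrow>
      R a b \<Longrightarrow> R b c \<Longrightarrow> R c d \<Longrightarrow> \<not> R a c \<Longrightarrow> R b d"
  shows "\<exists>v\<in>V. \<forall>w\<in>V - {v}. R v w"
proof -
  define N where "N v = {w \<in> V. R v w}" for v
  let ?d = "\<lambda>v. card (N v)"
  have "Max (?d ` V) \<in> ?d ` V"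
    using assms(1,2) by simp
  then obtain v where "v \<in> V" "?d v = Max (?d ` V)" by auto
  with assms(1) have v: "v \<in> V" "\<And>x. x \<in> V \<Longrightarrow> ?d x \<le> ?d v"
    by simp_all
  have "R v w" if w: "w \<in> V - {v}" for w
  proof (rule ccontr)
    assume "\<not> R v w"
    with w have "insert v (N v) \<subseteq> V" "insert v (N v) \<noteq> V"
      using v(1) by (auto simp: N_def)
    \<comment> \<open>An edge leaves the closed neighbourhood of \<open>v\<close>. Its inner end is
      not \<open>v\<close>, because \<open>y\<close> is not a neighbour of \<open>v\<close>.\<close>
    then obtain x y where x: "x \<in> insert v (N v)" and y: "y \<in> V - insert v (N v)" and xy: "R x y"
      using assms(3) unfolding connected_on_def by blast
    then have vx: "R v x" "x \<in> V" "\<not> R v y" "y \<noteq> v" by (auto simp: N_def)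
    have nbr: "x \<in> N v" "v \<notin> N v" "y \<notin> N v" "y \<noteq> v"
      using vx irrefl by (auto simp: N_def)
    have "\<exists>z\<in>N v. z \<noteq> x \<and> \<not> R x z"
    proof (rule ccontr)
      assume "\<not> ?thesis"
      then have "insert v (insert y (N v - {x})) \<subseteq> N x"
        using vx xy y v(1) sym by (auto simp: N_def)
      moreover have "finite (N u)" for u using assms(1) by (simp add: N_def)
      \<comment> \<open>\<open>x\<close> is traded for \<open>v\<close> and \<open>y\<close>, a net
        gain of one.\<close>
      moreover from this have "card (insert v (insert y (N v - {x}))) = Suc (card (N v))"
        using nbr by (simp add: card_Suc_Diff1 del: card_Diff_insert card_Diff_singleton)
      ultimately have "card (N v) < card (N x)"
        by (metis Suc_le_eq card_mono)
      then show False using v(2)[OF vx(2)] by simp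
    qed
    then obtain z where z: "z \<in> V" "R v z" "z \<noteq> x" "\<not> R x z" by (auto simp: N_def)
    moreover from this have "z \<noteq> v" "z \<noteq> y" "x \<noteq> v" "x \<noteq> y"
      using vx xy irrefl by auto
    \<comment> \<open>The path \<open>z v x y\<close> lacks the chords \<open>z x\<close> and
      \<open>v y\<close>.\<close>
    ultimately show False
      using free[of z v x y] v(1) vx xy y sym by auto
  qed
  then show ?thesis using v(1) by blast
qed

section \<open>The forbidden digraphs\<close>

abbreviation (input) special_digraphs :: "nat pair_pre_digraph set" where
  "special_digraphs \<equiv> {D1, D2, D3, D4, D5, D6, D7, D8, D9, D10, D11, D12, D13, D14, D15}"

lemmas special_digraph_defs = D1_def D2_def D3_def D4_def D5_def D6_def D7_def D8_def D9_def
  D10_def D11_def D12_def D13_def D14_def D15_def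

lemmas special_ops_defs = I2_def K2_def P2_def biarcs_def series_comp_def order_comp_def

lemmas special_defs = special_digraph_defs special_ops_defs

lemma is_digraph_special:
  "is_digraph D1" "is_digraph D2" "is_digraph D3" "is_digraph D4" "is_digraph D5"
  "is_digraph D6" "is_digraph D7" "is_digraph D8" "is_digraph D9" "is_digraph D10"
  "is_digraph D11" "is_digraph D12" "is_digraph D13" "is_digraph D14" "is_digraph D15"
  by (auto simp: is_digraph_iff special_defs)

lemma pverts_special:
  "pverts D1 = {0, 1, 2}" "pverts D2 = {0, 1, 2}" "pverts D3 = {0, 1, 2}"
  "pverts D4 = {0, 1, 2}" "pverts D5 = {0, 1, 2}" "pverts D6 = {0, 1, 2, 3}"
  "pverts D7 = {0, 1, 2, 3}" "pverts D8 = {0, 1, 2, 3}" "pverts D9 = {0, 1, 2, 3}"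
  "pverts D10 = {0, 1, 2, 3}" "pverts D11 = {0, 1, 2, 3}" "pverts D12 = {0, 1, 2, 3}"
  "pverts D13 = {0, 1, 2, 3}" "pverts D14 = {0, 1, 2, 3}" "pverts D15 = {0, 1, 2, 3}"
  by (auto simp: special_defs)

text \<open>Unfolding only below \<open>parcs\<close> keeps vertex sets in the form rewritten by
  \<open>pverts_special\<close>.\<close>

lemmas parcs_special = special_digraph_defs[THEN arg_cong[where f = parcs]] special_ops_defs

text \<open>List indexing sends 0, 1, 2 to \<open>a\<close>, \<open>b\<close>, \<open>c\<close>.
  Diagonal pairs agree because neither digraph has loops, which leaves six conditions.\<close>

lemma embeds3I:
  assumes "is_digraph D" "pverts D = {0, 1, 2 :: nat}" "is_digraph G"
    and "a \<in> pverts G" "b \<in> pverts G" "c \<in> pverts G" "distinct [a, b, c]"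
    and "(0, 1) \<in> parcs D \<longleftrightarrow> (a, b) \<in> parcs G" "(1, 0) \<in> parcs D \<longleftrightarrow> (b, a) \<in> parcs G"
    "(0, 2) \<in> parcs D \<longleftrightarrow> (a, c) \<in> parcs G" "(2, 0) \<in> parcs D \<longleftrightarrow> (c, a) \<in> parcs G"
    "(1, 2) \<in> parcs D \<longleftrightarrow> (b, c) \<in> parcs G" "(2, 1) \<in> parcs D \<longleftrightarrow> (c, b) \<in> parcs G"
  shows "embeds D G"
  unfolding embeds_def
  using assms by (intro exI[of _ "(!) [a, b, c]"]) (simp add: is_digraph_iff)

lemma embeds4I:
  assumes "is_digraph D" "pverts D = {0, 1, 2, 3 :: nat}" "is_digraph G"
    and "a \<in> pverts G" "b \<in> pverts G" "c \<in> pverts G" "d \<in> pverts G" "distinct [a, b, c, d]"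
    and "(0, 1) \<in> parcs D \<longleftrightarrow> (a, b) \<in> parcs G" "(1, 0) \<in> parcs D \<longleftrightarrow> (b, a) \<in> parcs G"
    "(0, 2) \<in> parcs D \<longleftrightarrow> (a, c) \<in> parcs G" "(2, 0) \<in> parcs D \<longleftrightarrow> (c, a) \<in> parcs G"
    "(0, 3) \<in> parcs D \<longleftrightarrow> (a, d) \<in> parcs G" "(3, 0) \<in> parcs D \<longleftrightarrow> (d, a) \<in> parcs G"
    "(1, 2) \<in> parcs D \<longleftrightarrow> (b, c) \<in> parcs G" "(2, 1) \<in> parcs D \<longleftrightarrow> (c, b) \<in> parcs G"
    "(1, 3) \<in> parcs D \<longleftrightarrow> (b, d) \<in> parcs G" "(3, 1) \<in> parcs D \<longleftrightarrow> (d, b) \<in> parcs G"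
    "(2, 3) \<in> parcs D \<longleftrightarrow> (c, d) \<in> parcs G" "(3, 2) \<in> parcs D \<longleftrightarrow> (d, c) \<in> parcs G"
  shows "embeds D G"
  unfolding embeds_def
  using assms by (intro exI[of _ "(!) [a, b, c, d]"]) (simp add: is_digraph_iff)

text \<open>A set that no edge leaves contains both ends or neither end of each edge of the
  path.\<close>

lemma connected_on_path:
  assumes "\<And>x y. R x y \<Longrightarrow> R y x"
  shows "R a b \<Longrightarrow> R b c \<Longrightarrow> connected_on {a, b, c} R"
    and "R a b \<Longrightarrow> R b c \<Longrightarrow> R c d \<Longrightarrow> connected_on {a, b, c, d} R"
proof -
  have *: "x \<in> A \<longleftrightarrow> y \<in> A" if "R x y" "x \<in> V" "y \<in> V" "\<not> (\<exists>x\<in>A. \<exists>y\<in>V - A. R x y)"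
    for x y :: 'a and A V
    using that assms by blast
  show "connected_on {a, b, c} R" if "R a b" "R b c"
    unfolding connected_on_def
  proof (intro allI impI, rule ccontr)
    fix A assume A: "A \<subseteq> {a, b, c}" "A \<noteq> {}" "A \<noteq> {a, b, c}"
      and "\<not> (\<exists>x\<in>A. \<exists>y\<in>{a, b, c} - A. R x y)"
    then have "a \<in> A \<longleftrightarrow> b \<in> A" "b \<in> A \<longleftrightarrow> c \<in> A"
      using * that by (metis insertCI)+
    then show False using A by blast
  qed
  show "connected_on {a, b, c, d} R" if "R a b" "R b c" "R c d"
    unfolding connected_on_def
  proof (intro allI impI, rule ccontr)
    fix A assume A: "A \<subseteq> {a, b, c, d}" "A \<noteq> {}" "A \<noteq> {a, b, c, d}"
      and "\<not> (\<exists>x\<in>A. \<exists>y\<in>{a, b, c, d} - A. R x y)"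
    then have "a \<in> A \<longleftrightarrow> b \<in> A" "b \<in> A \<longleftrightarrow> c \<in> A" "c \<in> A \<longleftrightarrow> d \<in> A"
      using * that by (metis insertCI)+
    then show False using A by blast
  qed
qed

lemma adjacent_sym: "adjacent G u v \<Longrightarrow> adjacent G v u"
  by (auto simp: adjacent_def)

lemma connected_special:
  assumes "D \<in> special_digraphs"
  shows "connected_on (pverts D) (adjacent D)"
proof -
  consider "D \<in> {D1, D2, D3, D4, D5}" | "D \<in> {D6, D7, D8}"
    | "D \<in> {D9, D10, D11, D12, D13, D14, D15}"
    using assms by blast
  then show ?thesis
  proof cases
    case 1
    then have "pverts D = {0, 1, 2}" "adjacent D 0 1" "adjacent D 1 2"
      by (auto simp: pverts_special parcs_special adjacent_def)
    then show ?thesis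
      using connected_on_path(1)[of "adjacent D"] adjacent_sym by metis
  next
    case 2
    then have "pverts D = {0, 1, 2, 3}" "adjacent D 0 1" "adjacent D 1 2" "adjacent D 2 3"
      by (auto simp: pverts_special parcs_special adjacent_def)
    then show ?thesis
      using connected_on_path(2)[of "adjacent D"] adjacent_sym by metis
  next
    case 3
    \<comment> \<open>The spanning path alternates between the operands, which have the vertices 0,
      1 and 2, 3.\<close>
    then have "pverts D = {0, 2, 1, 3}" "adjacent D 0 2" "adjacent D 2 1" "adjacent D 1 3"
      by (auto simp: pverts_special parcs_special adjacent_def)
    then show ?thesis
      using connected_on_path(2)[of "adjacent D"] adjacent_sym by metis
  qed
qed

lemma not_dominating_special:
  assumes "D \<in> special_digraphs"
  shows "\<forall>u\<in>pverts D. \<not> dominating D u"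
  using assms unfolding dominating_def biarc_def oneway_def
  by (elim insertE emptyE)
    (simp_all add: pverts_special parcs_special insert_Diff_if ex_disj_distrib)

lemma dtp_not_embeds_special:
  assumes "G \<in> directed_trivially_perfect"
    and "D \<in> special_digraphs"
  shows "\<not> embeds D G"
proof (rule dtp_not_embeds[OF assms(1) _ connected_special[OF assms(2)]])
  show "pverts D \<noteq> {}" using assms(2) by (auto simp: pverts_special)
qed (use not_dominating_special[OF assms(2)] in blast)

section \<open>Undirected graphs as symmetric digraphs\<close>

text \<open>Under this encoding, lemma \<open>dtp_not_embeds\<close> also handles \<open>C4\<close> and \<open>P4\<close>.\<close>

definition sym_digraph :: "'a ugraph \<Rightarrow> 'a pair_pre_digraph" where
  "sym_digraph H = \<lparr>pverts = uverts H, parcs = {(u, v). {u, v} \<in> uedges H}\<rparr>"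

lemma uFree_iff_not_embeds:
  fixes G :: "'a ugraph" and F :: "'b ugraph set"
  assumes "is_ugraph G"
  shows "G \<in> uFree F \<longleftrightarrow> (\<forall>D\<in>F. \<not> embeds (sym_digraph D) (sym_digraph G))"
proof -
  have "(\<exists>H. u_induced_subgraph H G \<and> u_iso D H) \<longleftrightarrow> embeds (sym_digraph D) (sym_digraph G)"
    for D :: "'b ugraph"
  proof
    assume "\<exists>H. u_induced_subgraph H G \<and> u_iso D H"
    then obtain H where "u_induced_subgraph H G" "u_iso D H"
      by blast
    then obtain f where H: "uverts H \<subseteq> uverts G" "uedges H = {e \<in> uedges G. e \<subseteq> uverts H}"
      and f: "inj_on f (uverts D)" "f ` uverts D = uverts H"
        "\<forall>u\<in>uverts D. \<forall>v\<in>uverts D. {u, v} \<in> uedges D \<longleftrightarrow> {f u, f v} \<in> uedges H"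
      unfolding u_induced_subgraph_def u_iso_def bij_betw_def by (elim exE conjE)
    have "{u, v} \<in> uedges D \<longleftrightarrow> {f u, f v} \<in> uedges G" if "u \<in> uverts D" "v \<in> uverts D" for u v
    proof -
      have "{f u, f v} \<subseteq> uverts H" using f(2) that by blast
      then show ?thesis using f(3) that unfolding H(2) by blast
    qed
    then show "embeds (sym_digraph D) (sym_digraph G)"
      unfolding embeds_def sym_digraph_def using f(1,2) H(1) by (intro exI[of _ f]) simp
  next
    assume "embeds (sym_digraph D) (sym_digraph G)"
    then obtain f where f: "inj_on f (uverts D)" "f ` uverts D \<subseteq> uverts G"
        "\<forall>u\<in>uverts D. \<forall>v\<in>uverts D. {u, v} \<in> uedges D \<longleftrightarrow> {f u, f v} \<in> uedges G"
      unfolding embeds_def sym_digraph_def by (elim exE conjE) simp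
    define H where "H = \<lparr>uverts = f ` uverts D, uedges = {e \<in> uedges G. e \<subseteq> f ` uverts D}\<rparr>"
    have "u_induced_subgraph H G"
      using f(2) by (simp add: u_induced_subgraph_def H_def)
    moreover have "u_iso D H"
      unfolding u_iso_def bij_betw_def H_def using f(1,3) by (intro exI[of _ f]) simp
    ultimately show "\<exists>H. u_induced_subgraph H G \<and> u_iso D H" by blast
  qed
  then show ?thesis using assms unfolding uFree_def by blast
qed

text \<open>Disjoint union becomes \<oplus>, and a new universal vertex becomes \<otimes> with one
  vertex.\<close>

lemma sym_digraph_dtp:
  "H \<in> trivially_perfect \<Longrightarrow> sym_digraph H \<in> directed_trivially_perfect"
proof (induction rule: trivially_perfect.induct)
  case (tp_vertex v)
  have "sym_digraph \<lparr>uverts = {v}, uedges = {}\<rparr> = one_vertex v"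
    by (simp add: sym_digraph_def one_vertex_def)
  then show ?case by (simp add: dtp_vertex)
next
  case (tp_union G\<^sub>1 G\<^sub>2)
  have "sym_digraph \<lparr>uverts = uverts G\<^sub>1 \<union> uverts G\<^sub>2, uedges = uedges G\<^sub>1 \<union> uedges G\<^sub>2\<rparr> =
      sym_digraph G\<^sub>1 \<oplus> sym_digraph G\<^sub>2"
    by (auto simp: sym_digraph_def disj_union_def)
  then show ?case
    using dtp_union[OF tp_union.IH] tp_union.hyps by (simp add: vertex_disjoint_def sym_digraph_def)
next
  case (tp_dominating G v)
  have "sym_digraph \<lparr>uverts = insert v (uverts G), uedges = uedges G \<union> {{u, v} |u. u \<in> uverts G}\<rparr> =
      sym_digraph G \<otimes> one_vertex v"
    by (auto simp: sym_digraph_def series_comp_def one_vertex_def doubleton_eq_iff)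
  then show ?case
    using dtp_series[OF tp_dominating.IH, of v] tp_dominating.hyps
    by (simp add: vertex_disjoint_def sym_digraph_def one_vertex_def)
qed

text \<open>With directions forgotten, all three compositions with one vertex add a vertex adjacent
  to all others.\<close>

lemma un_trivially_perfect:
  "G \<in> directed_trivially_perfect \<Longrightarrow> un G \<in> trivially_perfect"
proof (induction rule: directed_trivially_perfect.induct)
  case (dtp_vertex v)
  have "un (one_vertex v) = \<lparr>uverts = {v}, uedges = {}\<rparr>"
    by (simp add: un_def one_vertex_def)
  then show ?case by (simp add: tp_vertex)
next
  case (dtp_union G\<^sub>1 G\<^sub>2)
  have "un (G\<^sub>1 \<oplus> G\<^sub>2) = \<lparr>uverts = uverts (un G\<^sub>1) \<union> uverts (un G\<^sub>2),
      uedges = uedges (un G\<^sub>1) \<union> uedges (un G\<^sub>2)\<rparr>"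
    by (auto simp: un_def disj_union_def)
  then show ?case
    using tp_union[OF dtp_union.IH] dtp_union.hyps by (simp add: vertex_disjoint_def un_def)
next
  case (dtp_order_right G v)
  have "un (G \<oslash> one_vertex v) = \<lparr>uverts = insert v (uverts (un G)),
      uedges = uedges (un G) \<union> {{u, v} |u. u \<in> uverts (un G)}\<rparr>"
    by (auto simp: un_def order_comp_def one_vertex_def)
  then show ?case
    using tp_dominating[OF dtp_order_right.IH, of v] dtp_order_right.hyps
    by (simp add: vertex_disjoint_def un_def one_vertex_def)
next
  case (dtp_order_left G v)
  have "un (one_vertex v \<oslash> G) = \<lparr>uverts = insert v (uverts (un G)),
      uedges = uedges (un G) \<union> {{u, v} |u. u \<in> uverts (un G)}\<rparr>"
    by (auto simp: un_def order_comp_def one_vertex_def)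
  then show ?case
    using tp_dominating[OF dtp_order_left.IH, of v] dtp_order_left.hyps
    by (simp add: vertex_disjoint_def un_def one_vertex_def)
next
  case (dtp_series G v)
  have "un (G \<otimes> one_vertex v) = \<lparr>uverts = insert v (uverts (un G)),
      uedges = uedges (un G) \<union> {{u, v} |u. u \<in> uverts (un G)}\<rparr>"
    by (auto simp: un_def series_comp_def one_vertex_def)
  then show ?case
    using tp_dominating[OF dtp_series.IH, of v] dtp_series.hyps
    by (simp add: vertex_disjoint_def un_def one_vertex_def)
qed

lemma is_ugraph_un: "is_digraph G \<Longrightarrow> is_ugraph (un G)"
  unfolding is_ugraph_def un_def is_digraph_iff by auto

lemma mem_uedges_un: "{u, v} \<in> uedges (un G) \<longleftrightarrow> adjacent G u v"
  by (auto simp: un_def adjacent_def doubleton_eq_iff)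

lemma embeds_un: "embeds D G \<Longrightarrow> embeds (sym_digraph (un D)) (sym_digraph (un G))"
  unfolding embeds_def sym_digraph_def mem_uedges_un adjacent_def
  by (auto simp: un_def)

text \<open>Both graphs have the spanning path 0, 1, 2, 3 and no universal vertex, so
  \<open>dtp_not_embeds\<close> applies to their symmetric digraphs.\<close>

lemma trivially_perfect_C4_P4_free:
  assumes "H \<in> trivially_perfect" "D \<in> {C4, P4}"
  shows "\<not> embeds (sym_digraph D) (sym_digraph H)"
proof (rule dtp_not_embeds[OF sym_digraph_dtp[OF assms(1)]])
  let ?D = "sym_digraph D"
  have D: "pverts ?D = {0, 1, 2, 3}" "adjacent ?D 0 1" "adjacent ?D 1 2" "adjacent ?D 2 3"
    using assms(2) by (auto simp: sym_digraph_def C4_def P4_def adjacent_def)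
  then show "pverts ?D \<noteq> {}" by simp
  show "connected_on (pverts ?D) (adjacent ?D)"
    using D connected_on_path(2)[of "adjacent ?D"] adjacent_sym by metis
  have "\<forall>u\<in>pverts ?D. \<not> dominating ?D u"
    using assms(2) unfolding dominating_def biarc_def oneway_def
    by (elim insertE emptyE)
      (simp_all add: sym_digraph_def C4_def P4_def doubleton_eq_iff insert_Diff_if
        ex_disj_distrib)
  then show "\<not> dominating ?D u" if "u \<in> pverts ?D" for u
    using that by blast
qed

text \<open>The underlying graph of \<open>D7\<close> and \<open>D8\<close> is a path, that of
  \<open>D9\<close> and \<open>D12\<close> a 4-cycle. This is why conditions on \<open>un G\<close>
  can replace these four.\<close>

lemma C4_P4_embed_un_special:
  assumes "D \<in> {D7, D8, D9, D12}"
  shows "\<exists>H\<in>{C4, P4}. embeds (sym_digraph H) (sym_digraph (un D))"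
proof -
  consider "D \<in> {D7, D8}" | "D \<in> {D9, D12}" using assms by blast
  then show ?thesis
  proof cases
    case 1
    then have "embeds (sym_digraph P4) (sym_digraph (un D))"
      unfolding embeds_def sym_digraph_def mem_uedges_un adjacent_def
      by (intro exI[of _ id])
        (auto simp: un_def P4_def pverts_special parcs_special doubleton_eq_iff)
    then show ?thesis by blast
  next
    case 2
    then have "embeds (sym_digraph C4) (sym_digraph (un D))"
      unfolding embeds_def sym_digraph_def mem_uedges_un adjacent_def
      \<comment> \<open>The cycle has to alternate between the two operands.\<close>
      by (intro exI[of _ "(!) [0, 2, 1, 3]"])
        (auto simp: un_def C4_def pverts_special parcs_special doubleton_eq_iff)
    then show ?thesis by blast
  qed
qed

section \<open>Digraphs without forbidden induced subdigraphs\<close>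

locale special_free =
  fixes G :: "'a pair_pre_digraph"
  assumes digraph: "is_digraph G"
    and free: "D \<in> special_digraphs \<Longrightarrow>
      \<not> embeds D G"
begin

section \<open>The strict order given by the one-way arcs\<close>

abbreviation comparable :: "'a \<Rightarrow> 'a \<Rightarrow> bool" where
  "comparable u v \<equiv> oneway G u v \<or> oneway G v u"

lemma oneway_verts: "oneway G u v \<Longrightarrow> u \<in> pverts G \<and> v \<in> pverts G \<and> u \<noteq> v"
  using arc_in_verts[OF digraph] by (auto simp: oneway_def)

lemma biarc_verts: "biarc G u v \<Longrightarrow> u \<in> pverts G \<and> v \<in> pverts G \<and> u \<noteq> v"
  using arc_in_verts[OF digraph] by (auto simp: biarc_def)

lemma biarc_sym: "biarc G u v \<Longrightarrow> biarc G v u"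
  by (simp add: biarc_def)

lemma comparable_trichotomy:
  "comparable u v \<Longrightarrow> \<not> biarc G u v" "comparable u v \<or> biarc G u v \<or> \<not> adjacent G u v"
  by (auto simp: oneway_def biarc_def adjacent_def)

lemmas arc_simps = parcs_special oneway_def biarc_def adjacent_def

text \<open>Otherwise \<open>a\<close> and \<open>c\<close> are nonadjacent, bidirected or joined by
  a single arc from \<open>c\<close> to \<open>a\<close>: these are \<open>D1\<close>,
  \<open>D4\<close> and \<open>D5\<close>.\<close>

lemma oneway_trans:
  assumes "oneway G a b" "oneway G b c"
  shows "oneway G a c"
proof (rule ccontr)
  assume "\<not> oneway G a c"
  moreover have "a \<noteq> c" using assms by (auto simp: oneway_def)
  ultimately have "embeds D1 G \<or> embeds D4 G \<or> embeds D5 G"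
    using oneway_verts[OF assms(1)] oneway_verts[OF assms(2)] assms
      embeds3I[OF is_digraph_special(1) pverts_special(1) digraph, of a b c]
      embeds3I[OF is_digraph_special(4) pverts_special(4) digraph, of a b c]
      embeds3I[OF is_digraph_special(5) pverts_special(5) digraph, of a b c]
    unfolding oneway_def by (cases "(a, c) \<in> parcs G"; cases "(c, a) \<in> parcs G")
      (simp_all add: special_defs)
  then show False using free by blast
qed

text \<open>With pairs coloured comparable, bidirected or nonadjacent, a triangle of three colours
  is \<open>D3\<close> if its single arc leaves \<open>x\<close>, and \<open>D2\<close> if it enters
  \<open>x\<close>.\<close>

lemma no_rainbow:
  assumes "comparable x y" "biarc G x z" "y \<noteq> z"
  shows "comparable y z \<or> biarc G y z"
proof (rule ccontr)
  assume "\<not> ?thesis"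
  then have yz: "(y, z) \<notin> parcs G" "(z, y) \<notin> parcs G"
    unfolding oneway_def biarc_def by blast+
  have V: "y \<in> pverts G" "x \<in> pverts G" "z \<in> pverts G" "distinct [y, x, z]"
    using biarc_verts[OF assms(2)] assms(1,3) oneway_verts[of x y] oneway_verts[of y x] by auto
  note I = embeds3I[OF _ _ digraph V]
  from assms(1) have "embeds D2 G \<or> embeds D3 G"
  proof
    assume "oneway G x y"
    then show ?thesis
      using I[OF is_digraph_special(3) pverts_special(3)] assms(2) yz
      by (auto simp: arc_simps)
  next
    assume "oneway G y x"
    then show ?thesis
      using I[OF is_digraph_special(2) pverts_special(2)] assms(2) yz
      by (auto simp: arc_simps)
  qed
  then show False using free by blast
qed

text \<open>Each of the pairs \<open>a c\<close> and \<open>b d\<close> is bidirected or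
  nonadjacent; the four combinations are \<open>D12\<close> to \<open>D15\<close>.\<close>

lemma no_oneway_K22:
  assumes "oneway G a b" "oneway G a d" "oneway G c b" "oneway G c d"
    and "\<not> comparable a c" "\<not> comparable b d" "a \<noteq> c" "b \<noteq> d"
  shows False
proof -
  have "a \<in> pverts G" "b \<in> pverts G" "c \<in> pverts G" "d \<in> pverts G" "distinct [a, c, b, d]"
    using assms by (auto dest: oneway_verts)
  note I = embeds4I[OF _ _ digraph this(1) this(3) this(2) this(4) this(5)]
  have "embeds D12 G \<or> embeds D13 G \<or> embeds D14 G \<or> embeds D15 G"
    using assms I[OF is_digraph_special(12) pverts_special(12)]
      I[OF is_digraph_special(13) pverts_special(13)]
      I[OF is_digraph_special(14) pverts_special(14)] I[OF is_digraph_special(15) pverts_special(15)]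
    unfolding oneway_def
    by (cases "(a, c) \<in> parcs G"; cases "(b, d) \<in> parcs G") (simp_all add: special_defs)
  then show False using free by blast
qed

text \<open>By absence of rainbow triangles, \<open>a d\<close> has the colour of \<open>a c\<close>
  since \<open>c d\<close> is comparable, and that of \<open>b d\<close> since \<open>a b\<close>
  is. All three bidirected gives \<open>D6\<close>, all three nonadjacent gives
  \<open>D8\<close>.\<close>

lemma no_oneway_N:
  assumes "oneway G a b" "oneway G c b" "oneway G c d"
    and "\<not> comparable a c" "\<not> comparable b d" "\<not> comparable a d" "distinct [a, b, c, d]"
  shows False
proof -
  have V: "a \<in> pverts G" "b \<in> pverts G" "c \<in> pverts G" "d \<in> pverts G"
    using assms by (auto dest: oneway_verts)
  have ne: "c \<noteq> a" "d \<noteq> a" "b \<noteq> d" "a \<noteq> d" using assms(7) by auto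
  have ac: "biarc G a d \<longleftrightarrow> biarc G a c"
    using no_rainbow[of c d a] no_rainbow[of d c a] assms(3,4,6) ne biarc_sym by blast
  have bd: "biarc G a d \<longleftrightarrow> biarc G b d"
    using no_rainbow[of a b d] no_rainbow[of b a d] assms(1,5,6) ne biarc_sym by blast
  have "embeds D6 G \<or> embeds D8 G"
  proof (cases "biarc G a d")
    case True
    with ac bd have "biarc G a c" "biarc G b d" by auto
    then have "embeds D6 G"
      using embeds4I[OF is_digraph_special(6) pverts_special(6) digraph V(4,3,2,1)] assms(1-3,7) True
      by (auto simp: arc_simps)
    then show ?thesis ..
  next
    case False
    with ac bd have "\<not> adjacent G a c" "\<not> adjacent G b d" "\<not> adjacent G a d"
      using comparable_trichotomy(2) assms(4-6) by blast+
    then have "embeds D8 G"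
      using embeds4I[OF is_digraph_special(8) pverts_special(8) digraph V] assms(1-3,7)
      by (auto simp: arc_simps)
    then show ?thesis ..
  qed
  then show False using free by blast
qed

text \<open>Without the chords \<open>a c\<close> and \<open>b d\<close>, transitivity makes the
  directions along the path alternate. This leaves the configuration of \<open>no_oneway_K22\<close>
  or of \<open>no_oneway_N\<close>, according to whether \<open>a\<close> and \<open>d\<close> are
  comparable.\<close>

lemma comparable_P4_C4_free:
  assumes "distinct [a, b, c, d]" "comparable a b" "comparable b c" "comparable c d"
    and "\<not> comparable a c"
  shows "comparable b d"
proof (rule ccontr)
  assume bd: "\<not> comparable b d"
  from assms(2) show False
  proof
    assume ab: "oneway G a b"
    then have cb: "oneway G c b" using assms(3,5) oneway_trans by blast
    then have cd: "oneway G c d" using assms(4) bd oneway_trans by blast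
    show False
    proof (cases "comparable a d")
      case True
      then have "oneway G a d" using ab bd oneway_trans by blast
      then show False using no_oneway_K22[of a b d c] ab cb cd assms bd by auto
    next
      case False
      then show False using no_oneway_N[of a b c d] ab cb cd assms bd by auto
    qed
  next
    assume ba: "oneway G b a"
    then have bc: "oneway G b c" using assms(3,5) oneway_trans by blast
    then have dc: "oneway G d c" using assms(4) bd oneway_trans by blast
    show False
    proof (cases "comparable a d")
      case True
      then have "oneway G d a" using ba bd oneway_trans by blast
      then show False using no_oneway_K22[of b a c d] ba bc dc assms bd by auto
    next
      case False
      then show False using no_oneway_N[of d c b a] ba bc dc assms bd by auto
    qed
  qed
qed

text \<open>If \<open>a d\<close> is bidirected, each of \<open>a c\<close> and \<open>b d\<close>
  is nonadjacent or a single arc, which gives \<open>D9\<close>, \<open>D10\<close> or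
  \<open>D11\<close>. Otherwise \<open>no_rainbow\<close> forces both to have the colour of
  \<open>a d\<close>: nonadjacent gives \<open>D7\<close>, comparable contradicts
  \<open>comparable_P4_C4_free\<close>.\<close>

lemma biarc_P4_C4_free:
  assumes "distinct [a, b, c, d]" "biarc G a b" "biarc G b c" "biarc G c d" "\<not> biarc G a c"
  shows "biarc G b d"
proof (rule ccontr)
  assume bd: "\<not> biarc G b d"
  have V: "a \<in> pverts G" "b \<in> pverts G" "c \<in> pverts G" "d \<in> pverts G"
    using assms by (auto dest: biarc_verts)
  note I = embeds4I[OF _ _ digraph]
  show False
  proof (cases "biarc G a d")
    case True
    consider "\<not> adjacent G a c" "\<not> adjacent G b d"
      | "oneway G a c" "\<not> adjacent G b d"
      | "oneway G c a" "\<not> adjacent G b d"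
      | "\<not> adjacent G a c" "oneway G b d"
      | "\<not> adjacent G a c" "oneway G d b"
      | "oneway G a c" "oneway G b d"
      | "oneway G a c" "oneway G d b"
      | "oneway G c a" "oneway G b d"
      | "oneway G c a" "oneway G d b"
      using comparable_trichotomy(2)[of a c] comparable_trichotomy(2)[of b d] assms(5) bd by blast
    \<comment> \<open>The vertex orders put tails of single arcs before their heads and, for
      \<open>D10\<close>, the pair with the single arc first.\<close>
    then have "embeds D9 G \<or> embeds D10 G \<or> embeds D11 G"
    proof cases
      case 1
      then show ?thesis
        using I[OF is_digraph_special(9) pverts_special(9) V(1,3,2,4)] assms(1-4) True
        by (auto simp: arc_simps)
    next
      case 2
      then show ?thesis
        using I[OF is_digraph_special(10) pverts_special(10) V(1,3,2,4)] assms(1-4) True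
        by (auto simp: arc_simps)
    next
      case 3
      then show ?thesis
        using I[OF is_digraph_special(10) pverts_special(10) V(3,1,2,4)] assms(1-4) True
        by (auto simp: arc_simps)
    next
      case 4
      then show ?thesis
        using I[OF is_digraph_special(10) pverts_special(10) V(2,4,1,3)] assms(1-4) True
        by (auto simp: arc_simps)
    next
      case 5
      then show ?thesis
        using I[OF is_digraph_special(10) pverts_special(10) V(4,2,1,3)] assms(1-4) True
        by (auto simp: arc_simps)
    next
      case 6
      then show ?thesis
        using I[OF is_digraph_special(11) pverts_special(11) V(1,3,2,4)] assms(1-4) True
        by (auto simp: arc_simps)
    next
      case 7
      then show ?thesis
        using I[OF is_digraph_special(11) pverts_special(11) V(1,3,4,2)] assms(1-4) True
        by (auto simp: arc_simps)
    next
      case 8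
      then show ?thesis
        using I[OF is_digraph_special(11) pverts_special(11) V(3,1,2,4)] assms(1-4) True
        by (auto simp: arc_simps)
    next
      case 9
      then show ?thesis
        using I[OF is_digraph_special(11) pverts_special(11) V(3,1,4,2)] assms(1-4) True
        by (auto simp: arc_simps)
    qed
    then show False using free by blast
  next
    case ad: False
    have ne: "c \<noteq> a" "d \<noteq> a" "b \<noteq> d" "a \<noteq> c" using assms(1) by auto
    show False
    proof (cases "comparable a d")
      case True
      then have "comparable a c" "comparable b d"
        using no_rainbow[of d a c] no_rainbow[of a d b] ad assms(2,4,5) bd ne biarc_sym by blast+
      \<comment> \<open>The complement of a 4-vertex path is again one: \<open>c a d b\<close> is a
        path of comparable pairs whose chord \<open>c d\<close> is bidirected.\<close>
      then have "comparable a b"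
        using comparable_P4_C4_free[of c a d b] True assms(1,4) comparable_trichotomy(1) by auto
      then show False using assms(2) comparable_trichotomy(1) by blast
    next
      case False
      then have "\<not> comparable a c" "\<not> comparable b d"
        using no_rainbow[of c a d] no_rainbow[of b d a] ad assms(2,4,5) bd ne biarc_sym by blast+
      then have "\<not> adjacent G a c" "\<not> adjacent G b d" "\<not> adjacent G a d"
        using comparable_trichotomy(2) assms(5) bd ad False by blast+
      then have "embeds D7 G"
        using I[OF is_digraph_special(7) pverts_special(7) V] assms(1-4)
        by (auto simp: arc_simps)
      then show False using free by blast
    qed
  qed
qed

text \<open>By \<open>no_oneway_K22\<close> the vertices below \<open>v\<close> or those above
  \<open>v\<close> form a chain, since each of the former lies below each of the latter. Together
  with \<open>v\<close>, a lower chain contains a least element of all of \<open>G\<close>, an upper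
  chain a greatest one.\<close>

lemma comparable_universal_dominating:
  assumes "v \<in> pverts G" "\<And>w. w \<in> pverts G - {v} \<Longrightarrow> comparable v w"
  shows "\<exists>u\<in>pverts G. dominating G u"
proof -
  define I where "I = {w. oneway G w v}"
  define J where "J = {w. oneway G v w}"
  have V: "pverts G = insert v (I \<union> J)" "v \<notin> I" "v \<notin> J"
    using assms by (auto simp: I_def J_def dest: oneway_verts)
  then have fin: "finite I" "finite J"
    using digraph finite_subset by (auto simp: is_digraph_iff)
  have Iv: "oneway G x v" if "x \<in> I" for x
    using that by (simp add: I_def)
  have vJ: "oneway G v y" if "y \<in> J" for y
    using that by (simp add: J_def)
  have IJ: "oneway G x y" if "x \<in> I" "y \<in> J" for x y
    using oneway_trans[OF Iv vJ] that .
  have trans: "transp_on S (oneway G)" for S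
    by (auto intro: transp_onI oneway_trans)
  show ?thesis
  proof (cases "totalp_on I (oneway G)")
    case True
    then have "totalp_on (insert v I) (oneway G)"
      by (auto simp: totalp_on_def I_def)
    then obtain m where m: "m \<in> insert v I" "\<forall>x\<in>insert v I. x \<noteq> m \<longrightarrow> oneway G m x"
      using Finite_Set.bex_least_element[OF _ _ trans, of "insert v I"] fin by auto
    then have "oneway G m w" if "w \<in> pverts G - {m}" for w
    proof (cases "w \<in> insert v I")
      case False
      then have "w \<in> J" using that V(1) by blast
      then show ?thesis using m(1) IJ vJ by blast
    qed (use m(2) that in blast)
    then show ?thesis using m V unfolding dominating_def by blast
  next
    case False
    then obtain x y where "x \<in> I" "y \<in> I" "x \<noteq> y" "\<not> comparable x y"
      by (auto simp: totalp_on_def)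
    then have "totalp_on J (oneway G)"
      unfolding totalp_on_def using no_oneway_K22[of x _ _ y] IJ by blast
    then have "totalp_on (insert v J) (oneway G)"
      by (auto simp: totalp_on_def J_def)
    then obtain m where m: "m \<in> insert v J" "\<forall>x\<in>insert v J. x \<noteq> m \<longrightarrow> oneway G x m"
      using Finite_Set.bex_greatest_element[OF _ _ trans, of "insert v J"] fin by auto
    then have "oneway G w m" if "w \<in> pverts G - {m}" for w
    proof (cases "w \<in> insert v J")
      case False
      then have "w \<in> I" using that V(1) by blast
      then show ?thesis using m(1) IJ Iv by blast
    qed (use m(2) that in blast)
    then show ?thesis using m V unfolding dominating_def by blast
  qed
qed

text \<open>For \<open>biarc\<close> the universal vertex itself is dominating; for
  \<open>comparable\<close> the dominating vertex may be another one.\<close>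

lemma ex_dominating:
  assumes "connected_on (pverts G) (adjacent G)"
  shows "\<exists>v\<in>pverts G. dominating G v"
proof -
  have fin: "finite (pverts G)" "pverts G \<noteq> {}"
    using digraph by (auto simp: is_digraph_iff)
  have "connected_on (pverts G) comparable \<or> connected_on (pverts G) (biarc G)"
  proof (rule connected_on_cases)
    have "adjacent G = (\<lambda>x y. comparable x y \<or> biarc G x y)"
      by (auto simp: fun_eq_iff adjacent_def oneway_def biarc_def)
    then show "connected_on (pverts G) (\<lambda>x y. comparable x y \<or> biarc G x y)"
      using assms by simp
  qed (use biarc_sym no_rainbow in blast)+
  then show ?thesis
  proof
    assume "connected_on (pverts G) comparable"
    then have "\<exists>v\<in>pverts G. \<forall>w\<in>pverts G - {v}. comparable v w"
    proof (rule connected_P4_C4_free_universal[OF fin])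
      show "\<not> comparable x x" for x
        by (simp add: oneway_def)
      show "comparable b d" if "distinct [a, b, c, d]" "comparable a b" "comparable b c"
        "comparable c d" "\<not> comparable a c" for a b c d
        using that by (rule comparable_P4_C4_free)
    qed auto
    then show ?thesis using comparable_universal_dominating by blast
  next
    assume "connected_on (pverts G) (biarc G)"
    then have "\<exists>v\<in>pverts G. \<forall>w\<in>pverts G - {v}. biarc G v w"
    proof (rule connected_P4_C4_free_universal[OF fin])
      show "\<not> biarc G x x" for x
        using biarc_verts by blast
      show "biarc G b d" if "distinct [a, b, c, d]" "biarc G a b" "biarc G b c"
        "biarc G c d" "\<not> biarc G a c" for a b c d
        using that by (rule biarc_P4_C4_free)
    qed (rule biarc_sym)
    then show ?thesis unfolding dominating_def by blast
  qed
qed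

section \<open>Induction on the number of vertices\<close>

lemma special_free_induce:
  assumes "A \<subseteq> pverts G" "A \<noteq> {}"
  shows "special_free (induce G A)"
proof
  show "is_digraph (induce G A)"
    using is_digraph_induce digraph assms by blast
  show "\<not> embeds D (induce G A)"
    if "D \<in> special_digraphs" for D
    using free[OF that] embeds_trans embeds_induce[OF assms(1)] by blast
qed

end

text \<open>A disconnected digraph is split along a cut; a connected one loses a dominating
  vertex.\<close>

lemma special_free_imp_dtp:
  "special_free G \<Longrightarrow> G \<in> directed_trivially_perfect"
proof (induction "card (pverts G)" arbitrary: G rule: less_induct)
  case less
  then interpret special_free G by simp
  have fin: "finite (pverts G)" and ne: "pverts G \<noteq> {}"
    using digraph by (auto simp: is_digraph_iff)
  have IH: "induce G A \<in> directed_trivially_perfect" if "A \<subset> pverts G" "A \<noteq> {}" for A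
    using less.hyps[OF _ special_free_induce] that psubset_card_mono[OF fin]
    by (auto simp: induce_def)
  show ?case
  proof (cases "connected_on (pverts G) (adjacent G)")
    case False
    then obtain A where A: "A \<subset> pverts G" "A \<noteq> {}"
        "\<And>a b. a \<in> A \<Longrightarrow> b \<in> pverts G - A \<Longrightarrow> \<not> adjacent G a b"
      unfolding connected_on_def by blast
    then show ?thesis
      by (intro dtp_partI[of G A "pverts G - A"] digraph IH) auto
  next
    case True
    then obtain v where v: "v \<in> pverts G" "dominating G v"
      using ex_dominating by blast
    show ?thesis
    \<comment> \<open>Deleting the only vertex would leave no digraph, so this is the base
      case.\<close>
    proof (cases "pverts G = {v}")
      case True
      then have "parcs G = {}"
        using digraph by (auto simp: is_digraph_iff)
      with True have "G = one_vertex v"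
        by (simp add: one_vertex_def)
      then show ?thesis by (simp add: dtp_vertex)
    next
      case False
      then show ?thesis
        by (intro dtp_dominatingI[OF digraph v] IH) (use v in auto)
    qed
  qed
qed

theorem theorem4p18:
  fixes G :: "'a pair_pre_digraph"
  assumes "is_digraph G"
  shows "(G \<in> directed_trivially_perfect \<longleftrightarrow>
            G \<in> Free {D1, D2, D3, D4, D5, D6, D7, D8, D9, D10, D11, D12, D13, D14, D15}) \<and>
         (G \<in> directed_trivially_perfect \<longleftrightarrow>
            G \<in> Free {D1, D2, D3, D4, D5, D6, D10, D11, D13, D14, D15} \<and> un G \<in> uFree {C4, P4}) \<and>
         (G \<in> directed_trivially_perfect \<longleftrightarrow>
            G \<in> Free {D1, D2, D3, D4, D5, D6, D10, D11, D13, D14, D15} \<and> un G \<in> trivially_perfect)"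
proof -
  let ?S = "{D1, D2, D3, D4, D5, D6, D10, D11, D13, D14, D15}"
  have Free: "G \<in> Free F \<longleftrightarrow> (\<forall>D\<in>F. \<not> embeds D G)" if "F \<subseteq> special_digraphs" for F
    using that is_digraph_special by (intro Free_iff_not_embeds[OF assms]) blast
  have uFree: "un G \<in> uFree {C4, P4} \<longleftrightarrow>
      (\<forall>D\<in>{C4, P4}. \<not> embeds (sym_digraph D) (sym_digraph (un G)))"
    by (rule uFree_iff_not_embeds[OF is_ugraph_un[OF assms]])
  \<comment> \<open>The implications form a cycle: membership, \<open>un G\<close> trivially
    perfect, \<open>un G\<close> free of \<open>C4\<close> and \<open>P4\<close>, freeness from all
    fifteen digraphs, membership.\<close>
  have "G \<in> directed_trivially_perfect \<Longrightarrow> G \<in> Free special_digraphs"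
    using Free dtp_not_embeds_special by blast
  moreover have "G \<in> Free special_digraphs \<Longrightarrow> G \<in> directed_trivially_perfect"
    using Free[OF subset_refl] assms by (intro special_free_imp_dtp special_free.intro) blast+
  moreover have "G \<in> directed_trivially_perfect \<Longrightarrow> G \<in> Free ?S"
    using Free[of ?S] dtp_not_embeds_special by blast
  moreover have "un G \<in> trivially_perfect \<Longrightarrow> un G \<in> uFree {C4, P4}"
    using uFree trivially_perfect_C4_P4_free by blast
  moreover have "G \<in> Free special_digraphs" if "G \<in> Free ?S" "un G \<in> uFree {C4, P4}"
  proof -
    \<comment> \<open>Embeddings survive the passage to underlying graphs, so the four digraphs
      missing from \<open>?S\<close> would bring \<open>C4\<close> or \<open>P4\<close> into
      \<open>un G\<close>.\<close>
    have "\<not> embeds D G" if "D \<in> {D7, D8, D9, D12}" for D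
      using C4_P4_embed_un_special[OF that] embeds_un embeds_trans uFree \<open>un G \<in> uFree {C4, P4}\<close>
      by blast
    moreover have "\<not> embeds D G" if "D \<in> ?S" for D
      using Free[of ?S] \<open>G \<in> Free ?S\<close> that by blast
    ultimately show ?thesis
      using Free[OF subset_refl] by blast
  qed
  ultimately show ?thesis
    using un_trivially_perfect by blast
qed

end
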